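(* Let $G$ be a finite non-abelian group and let $m=|G|/|Z(G)|$. The following are equivalent: (1) $G$ is an $m$-centralizer $\mathrm{CA}$-group and $m\neq 2,3$. (2) $G=A\times P$, where $A$ and $P$ are groups, $P$ is a $2$-group, $P$ is a $\mathrm{CA}$-group and $|\mathrm{Cent}(P)|=|P|/|Z(P)|$. (3) $G=A\times P$, where $A$ and $P$ are groups and $C_P(x)=Z(P)\cup xZ(P)$ for all $x\in P\setminus Z(P)$.
   Context: All groups are finite. $Z(G)$ is the center of $G$, $C_G(x)$ is the centralizer of $x$ in $G$, and $\mathrm{Cent}(G)=\{C_G(x): x\in G\}$ is the set of element centralizers of $G$. A group $G$ is called $n$-centralizer if $|\mathrm{Cent}(G)|=n$. A non-abelian group $G$ is called a $\mathrm{CA}$-group if $C_G(x)$ is abelian for all $x\in G\setminus Z(G)$.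
   Formalization: In (2) and (3) the factor A is required to be abelian; for arbitrary A the claim is false: G = S3 with A = S3, P = 1 satisfies (3) but not (1), and G = S3 × D8 with A = S3, P = D8 satisfies (2) but not (1). *)

theory Defs
  imports "HOL-Algebra.Algebra"
begin

definition centralizer :: "('a, 'b) monoid_scheme \<Rightarrow> 'a \<Rightarrow> 'a set" where
  "centralizer G x = {y \<in> carrier G. x \<otimes>\<^bsub>G\<^esub> y = y \<otimes>\<^bsub>G\<^esub> x}"

definition center :: "('a, 'b) monoid_scheme \<Rightarrow> 'a set" where
  "center G = {z \<in> carrier G. \<forall>y \<in> carrier G. z \<otimes>\<^bsub>G\<^esub> y = y \<otimes>\<^bsub>G\<^esub> z}"

definition Cent :: "('a, 'b) monoid_scheme \<Rightarrow> 'a set set" where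
  "Cent G = centralizer G ` carrier G"

definition n_centralizer :: "nat \<Rightarrow> ('a, 'b) monoid_scheme \<Rightarrow> bool" where
  "n_centralizer n G \<longleftrightarrow> group G \<and> finite (carrier G) \<and> card (Cent G) = n"

text \<open>A CA-group is non-abelian by definition.\<close>

definition CA_group :: "('a, 'b) monoid_scheme \<Rightarrow> bool" where
  "CA_group G \<longleftrightarrow> group G \<and> finite (carrier G) \<and> \<not> comm_group G \<and>
     (\<forall>x \<in> carrier G - center G. comm_group (G\<lparr>carrier := centralizer G x\<rparr>))"

definition two_group :: "('a, 'b) monoid_scheme \<Rightarrow> bool" where
  "two_group G \<longleftrightarrow> group G \<and> (\<exists>k. order G = 2 ^ k)"

text \<open>\<open>G = A \<times> P\<close> as an internal direct product. The factors are subsets of the carrier of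
  \<open>G\<close>; as groups they are \<open>G\<lparr>carrier := A\<rparr>\<close> and \<open>G\<lparr>carrier := P\<rparr>\<close>.\<close>

definition internal_direct_product :: "('a, 'b) monoid_scheme \<Rightarrow> 'a set \<Rightarrow> 'a set \<Rightarrow> bool" where
  "internal_direct_product G A P \<longleftrightarrow>
     A \<lhd> G \<and> P \<lhd> G \<and> A \<inter> P = {\<one>\<^bsub>G\<^esub>} \<and> A <#>\<^bsub>G\<^esub> P = carrier G"

end

theory Submission
  imports Defs
begin

text \<open>All three conditions amount to \<open>C(x) = Z \<union> xZ\<close> for every noncentral \<open>x\<close>.
  Centralizers are constant on cosets of \<open>Z\<close>, so a group has at most \<open>|G/Z|\<close> of them, with
  equality if and only if distinct cosets have distinct centralizers; for a CA-group this says that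
  \<open>C(x) - Z\<close> is the single coset \<open>xZ\<close>. The condition passes between \<open>G\<close> and \<open>P\<close> when
  \<open>G = A \<times> P\<close> with \<open>A\<close> abelian, since then \<open>A\<close> is central. Finally, \<open>x\<^sup>2\<close> commutes with
  \<open>x\<close> but lies in \<open>xZ\<close> only if \<open>x\<close> is central, so all squares are central. Hence elements of
  odd order are central, the elements of 2-power order form a subgroup, and \<open>G\<close> is the direct
  product of these two parts.\<close>

text \<open>It holds vacuously for abelian groups, so non-commutativity is carried separately
  wherever it is compared with \<open>CA_group\<close>.\<close>

definition small_centralizers :: "('a, 'b) monoid_scheme \<Rightarrow> bool" where
  "small_centralizers G \<longleftrightarrow>
     (\<forall>x \<in> carrier G - center G. centralizer G x = center G \<union> (x <#\<^bsub>G\<^esub> center G))"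

section \<open>Centralizers and the center\<close>

lemma centerD: "z \<in> center G \<Longrightarrow> y \<in> carrier G \<Longrightarrow> z \<otimes>\<^bsub>G\<^esub> y = y \<otimes>\<^bsub>G\<^esub> z"
  by (simp add: center_def)

lemma center_subset: "center G \<subseteq> carrier G"
  by (auto simp: center_def)

lemma centralizer_subset: "centralizer G x \<subseteq> carrier G"
  by (auto simp: centralizer_def)

lemma center_subset_centralizer: "x \<in> carrier G \<Longrightarrow> center G \<subseteq> centralizer G x"
  by (auto simp: center_def centralizer_def)

lemma centralizer_self: "x \<in> carrier G \<Longrightarrow> x \<in> centralizer G x"
  by (simp add: centralizer_def)

lemma centralizer_sym:
  "x \<in> carrier G \<Longrightarrow> y \<in> centralizer G x \<Longrightarrow> x \<in> centralizer G y"
  by (simp add: centralizer_def)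

lemma centralizer_eq_carrier_iff:
  "x \<in> carrier G \<Longrightarrow> centralizer G x = carrier G \<longleftrightarrow> x \<in> center G"
  by (auto simp: centralizer_def center_def)

lemma center_carrier_update:
  "center (G\<lparr>carrier := H\<rparr>) = {z \<in> H. \<forall>y\<in>H. z \<otimes>\<^bsub>G\<^esub> y = y \<otimes>\<^bsub>G\<^esub> z}"
  by (simp add: center_def)

lemma l_coset_carrier_update: "x <#\<^bsub>G\<lparr>carrier := H\<rparr>\<^esub> K = x <#\<^bsub>G\<^esub> K"
  by (simp add: l_coset_def)

lemma mem_l_coset: "y \<in> x <#\<^bsub>G\<^esub> K \<longleftrightarrow> (\<exists>k\<in>K. y = x \<otimes>\<^bsub>G\<^esub> k)"
  by (auto simp: l_coset_def)

context group
begin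

lemma subgroup_center: "subgroup (center G) G"
proof (rule subgroupI)
  have "\<one> \<in> center G" by (simp add: center_def)
  then show "center G \<noteq> {}" by blast
  fix a assume a: "a \<in> center G"
  then have ac: "a \<in> carrier G" by (simp add: center_def)
  have "inv a \<otimes> y = y \<otimes> inv a" if "y \<in> carrier G" for y
    using ac that centerD[OF a that] by (metis inv_closed inv_solve_left inv_solve_right m_assoc m_closed)
  with ac show "inv a \<in> center G" by (simp add: center_def)
next
  fix a b assume a: "a \<in> center G" and b: "b \<in> center G"
  then have c: "a \<in> carrier G" "b \<in> carrier G" by (simp_all add: center_def)
  have "(a \<otimes> b) \<otimes> y = y \<otimes> (a \<otimes> b)" if y: "y \<in> carrier G" for y
  proof -
    have "(a \<otimes> b) \<otimes> y = a \<otimes> (y \<otimes> b)" using c y centerD[OF b y] by (simp add: m_assoc)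
    also have "\<dots> = (y \<otimes> a) \<otimes> b" using c y centerD[OF a y] by (simp flip: m_assoc)
    finally show ?thesis using c y by (simp add: m_assoc)
  qed
  with c show "a \<otimes> b \<in> center G" by (simp add: center_def)
qed (rule center_subset)

lemma subgroup_centralizer:
  assumes x: "x \<in> carrier G"
  shows "subgroup (centralizer G x) G"
proof (rule subgroupI)
  show "centralizer G x \<noteq> {}" using centralizer_self[OF x] by blast
  fix a assume a: "a \<in> centralizer G x"
  then have ac: "a \<in> carrier G" and e: "x \<otimes> a = a \<otimes> x" by (simp_all add: centralizer_def)
  have "x \<otimes> inv a = inv a \<otimes> x"
    using x ac e by (metis inv_closed inv_solve_left inv_solve_right m_assoc m_closed)
  with ac show "inv a \<in> centralizer G x" by (simp add: centralizer_def)
next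
  fix a b assume "a \<in> centralizer G x" "b \<in> centralizer G x"
  then show "a \<otimes> b \<in> centralizer G x"
    using x by (simp add: centralizer_def) (metis m_assoc)
qed (rule centralizer_subset)

lemma center_cosets_subset_centralizer:
  assumes x: "x \<in> carrier G"
  shows "center G \<union> (x <# center G) \<subseteq> centralizer G x"
proof -
  interpret C: subgroup "centralizer G x" G using x by (rule subgroup_centralizer)
  have "center G \<subseteq> centralizer G x" using x by (rule center_subset_centralizer)
  moreover have "x \<in> centralizer G x" using x by (rule centralizer_self)
  ultimately show ?thesis by (auto simp: mem_l_coset intro!: C.m_closed)
qed

text \<open>The factor \<open>z\<close> moves to the front on both sides of the commutation equation
  and cancels. This makes the map from cosets of the center to centralizers well defined.\<close>

lemma centralizer_mult_center:
  assumes "x \<in> carrier G" "z \<in> center G"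
  shows "centralizer G (z \<otimes> x) = centralizer G x"
proof -
  have zc: "z \<in> carrier G" using assms(2) by (simp add: center_def)
  have "(z \<otimes> x) \<otimes> y = y \<otimes> (z \<otimes> x) \<longleftrightarrow> x \<otimes> y = y \<otimes> x" if "y \<in> carrier G" for y
  proof -
    have "(z \<otimes> x) \<otimes> y = z \<otimes> (x \<otimes> y)" using assms zc that by (simp add: m_assoc)
    moreover have "y \<otimes> (z \<otimes> x) = z \<otimes> (y \<otimes> x)"
      using assms zc that centerD[OF assms(2) that] by (metis m_assoc)
    ultimately show ?thesis using assms zc that by simp
  qed
  then show ?thesis by (auto simp: centralizer_def)
qed

lemma central_subgroup_normal:
  assumes "subgroup A G" "A \<subseteq> center G"
  shows "A \<lhd> G"
  unfolding normal_inv_iff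
proof (intro conjI ballI)
  fix x h assume x: "x \<in> carrier G" and h: "h \<in> A"
  then have "h \<in> center G" using assms(2) by blast
  then have "x \<otimes> h \<otimes> inv x = h \<otimes> x \<otimes> inv x" using x centerD[of h G x] by simp
  also have "\<dots> = h" using x h assms(1) by (simp add: m_assoc subgroup.mem_carrier)
  finally show "x \<otimes> h \<otimes> inv x \<in> A" using h by simp
qed (rule assms(1))

section \<open>Counting element centralizers against cosets of the center\<close>

lemma not_comm_group_ex_noncentral:
  assumes "\<not> comm_group G"
  obtains x where "x \<in> carrier G - center G"
proof -
  have "\<exists>x \<in> carrier G. x \<notin> center G"
  proof (rule ccontr)
    assume "\<not> ?thesis"
    then have "comm_group G" by (intro group_comm_groupI) (auto simp: center_def)
    with assms show False by simp
  qed
  then show thesis using that by blast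
qed

text \<open>For non-commuting \<open>x\<close> and \<open>y\<close>, the elements 1,
  \<open>x\<close>, \<open>y\<close> and \<open>xy\<close> have pairwise distinct centralizers. The
  bound supplies \<open>m \<noteq> 2\<close> and \<open>m \<noteq> 3\<close> in the first condition
  of the theorem.\<close>

lemma card_Cent_ge_4:
  assumes fin: "finite (carrier G)" and nc: "\<not> comm_group G"
  shows "card (Cent G) \<ge> 4"
proof -
  obtain x where x: "x \<in> carrier G" and xz: "x \<notin> center G"
    using not_comm_group_ex_noncentral[OF nc] by blast
  then obtain y where y: "y \<in> carrier G" and xy: "x \<otimes> y \<noteq> y \<otimes> x"
    by (auto simp: center_def)
  let ?C = "centralizer G"
  \<comment> \<open>If \<open>xy\<close> commuted with \<open>x\<close> or with \<open>y\<close>,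
    cancelling that factor would give \<open>xy = yx\<close>.\<close>
  have nx: "x \<notin> ?C (x \<otimes> y)" and ny: "y \<notin> ?C (x \<otimes> y)"
    using x y xy by (auto simp: centralizer_def m_assoc) (metis m_assoc m_closed r_cancel)
  have yx: "y \<notin> ?C x" "x \<notin> ?C y" using xy by (auto simp: centralizer_def)
  have "card {?C \<one>, ?C x, ?C y, ?C (x \<otimes> y)} = 4"
  proof -
    have 1: "?C \<one> = carrier G" by (auto simp: centralizer_def)
    have "?C \<one> \<noteq> ?C x" "?C \<one> \<noteq> ?C y" "?C \<one> \<noteq> ?C (x \<otimes> y)"
      using 1 x y yx nx by auto
    moreover have "?C x \<noteq> ?C y" "?C x \<noteq> ?C (x \<otimes> y)" "?C y \<noteq> ?C (x \<otimes> y)"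
      using yx nx ny centralizer_self[OF x] centralizer_self[OF y] by auto
    ultimately show ?thesis by simp
  qed
  moreover have "{?C \<one>, ?C x, ?C y, ?C (x \<otimes> y)} \<subseteq> Cent G"
    using x y by (auto simp: Cent_def)
  moreover have "finite (Cent G)" using fin by (simp add: Cent_def)
  ultimately show ?thesis by (metis card_mono)
qed

text \<open>Sending the coset of \<open>x\<close> to the centralizer of \<open>x\<close> is a
  surjection from the finite set of cosets of the center onto \<open>Cent G\<close>, so the two
  cardinalities agree exactly when this map is injective.\<close>

lemma card_Cent_eq_index_center_iff:
  assumes fin: "finite (carrier G)"
  shows "card (Cent G) = order G div card (center G) \<longleftrightarrow>
    (\<forall>x\<in>carrier G. \<forall>y\<in>carrier G. centralizer G x = centralizer G y \<longrightarrow>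
       center G #> x = center G #> y)"
proof -
  let ?C = "centralizer G" and ?Z = "center G"
  interpret Z: subgroup ?Z G by (rule subgroup_center)
  have "finite ?Z" using fin by (rule finite_subset[OF center_subset])
  then have "card ?Z > 0" unfolding card_gt_0_iff using Z.one_closed by blast
  then have idx: "order G div card ?Z = card (rcosets ?Z)"
    by (simp flip: lagrange[OF subgroup_center])
  have rc: "rcosets ?Z = (\<lambda>x. ?Z #> x) ` carrier G" by (auto simp: RCOSETS_def)
  \<comment> \<open>Every representative of a coset has the same centralizer, so the map
    \<open>f\<close> on cosets may pick one with \<open>SOME\<close>.\<close>
  have C_some: "?C (SOME y. y \<in> ?Z #> x) = ?C x" if x: "x \<in> carrier G" for x
  proof -
    have "(SOME y. y \<in> ?Z #> x) \<in> ?Z #> x"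
      using rcos_self[OF x subgroup_center] by (rule someI)
    then obtain z where "z \<in> ?Z" "(SOME y. y \<in> ?Z #> x) = z \<otimes> x"
      by (auto simp: r_coset_def)
    then show ?thesis using centralizer_mult_center[OF x] by simp
  qed
  define f where "f R = ?C (SOME y. y \<in> R)" for R
  have fC: "f (?Z #> x) = ?C x" if "x \<in> carrier G" for x
    using C_some[OF that] by (simp add: f_def)
  have img: "f ` (rcosets ?Z) = Cent G"
    unfolding rc Cent_def image_image using fC by (intro image_cong) auto
  have "finite (rcosets ?Z)" using fin rc by simp
  then have "card (Cent G) = card (rcosets ?Z) \<longleftrightarrow> inj_on f (rcosets ?Z)"
    unfolding img[symmetric] by (meson card_image eq_card_imp_inj_on)
  also have "\<dots> \<longleftrightarrow> (\<forall>x\<in>carrier G. \<forall>y\<in>carrier G. ?C x = ?C y \<longrightarrow> ?Z #> x = ?Z #> y)"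
    unfolding inj_on_def rc by (auto simp: fC)
  finally show ?thesis by (simp only: idx)
qed

text \<open>The center is normal, so its left and right cosets agree. This links the right cosets
  counted by Lagrange's theorem to the left cosets in \<open>small_centralizers\<close>.\<close>

lemma center_coset_eq_iff:
  assumes "x \<in> carrier G" "y \<in> carrier G"
  shows "center G #> x = center G #> y \<longleftrightarrow> y \<in> x <# center G"
proof -
  have comm: "center G #> x = x <# center G"
    using normal.coset_eq[OF central_subgroup_normal[OF subgroup_center order_refl]] assms(1) by blast
  show ?thesis unfolding comm[symmetric]
    using assms repr_independence[OF _ assms(1) subgroup_center]
      repr_independenceD[OF subgroup_center assms(2)] by blast
qed

text \<open>Forward: if \<open>y\<close> is noncentral in the abelian group \<open>C(x)\<close>,
  then \<open>C(x) \<subseteq> C(y)\<close>, and by symmetry the two are equal, so injectivity on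
  cosets puts \<open>y\<close> into \<open>xZ\<close>. Backward: an element of
  \<open>Z \<union> xZ\<close> is central or has the same centralizer as \<open>x\<close>, so
  \<open>C(x)\<close> is abelian; and \<open>C(x) = C(y)\<close> puts a noncentral \<open>y\<close>
  into \<open>xZ\<close>.\<close>

lemma CA_group_max_Cent_iff:
  assumes fin: "finite (carrier G)" and nc: "\<not> comm_group G"
  shows "CA_group G \<and> card (Cent G) = order G div card (center G) \<longleftrightarrow> small_centralizers G"
proof
  assume L: "CA_group G \<and> card (Cent G) = order G div card (center G)"
  then have inj: "\<And>x y. \<lbrakk>x \<in> carrier G; y \<in> carrier G; centralizer G x = centralizer G y\<rbrakk>
      \<Longrightarrow> y \<in> x <# center G"
    using card_Cent_eq_index_center_iff[OF fin] center_coset_eq_iff by blast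
  have sub: "centralizer G x \<subseteq> centralizer G y"
    if "x \<in> carrier G - center G" "y \<in> centralizer G x" for x y
  proof
    interpret C: comm_group "G\<lparr>carrier := centralizer G x\<rparr>"
      using L that by (simp add: CA_group_def)
    fix w assume w: "w \<in> centralizer G x"
    then have "y \<otimes> w = w \<otimes> y" using C.m_comm that by simp
    with w show "w \<in> centralizer G y" by (simp add: centralizer_def)
  qed
  show "small_centralizers G"
    unfolding small_centralizers_def
  proof (intro ballI equalityI subsetI)
    fix x y assume x: "x \<in> carrier G - center G" and y: "y \<in> centralizer G x"
    show "y \<in> center G \<union> (x <# center G)"
    proof (cases "y \<in> center G")
      case False
      then have yc: "y \<in> carrier G - center G" using y by (auto simp: centralizer_def)
      have "centralizer G x = centralizer G y"
        using sub[OF x y] sub[OF yc centralizer_sym] x y by blast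
      then show ?thesis using inj x yc by blast
    qed simp
  next
    fix x y assume x: "x \<in> carrier G - center G" and y: "y \<in> center G \<union> (x <# center G)"
    then show "y \<in> centralizer G x" using center_cosets_subset_centralizer[of x] by blast
  qed
next
  assume S: "small_centralizers G"
  have "CA_group G"
    unfolding CA_group_def
  proof (intro conjI ballI is_group fin nc)
    fix x assume x: "x \<in> carrier G - center G"
    have sg: "subgroup (centralizer G x) G" using x subgroup_centralizer by simp
    have C: "centralizer G x = center G \<union> (x <# center G)"
      using S x by (simp add: small_centralizers_def)
    have comm: "a \<otimes> b = b \<otimes> a" if ab: "a \<in> centralizer G x" "b \<in> centralizer G x" for a b
    proof -
      have "b \<in> centralizer G a"
      proof (cases "a \<in> center G")
        case True
        then show ?thesis using ab by (auto simp: center_def centralizer_def)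
      next
        case False
        then obtain z where z: "z \<in> center G" "a = x \<otimes> z" using ab C by (auto simp: mem_l_coset)
        then have "a = z \<otimes> x" using x by (simp add: centerD)
        then show ?thesis using ab z x centralizer_mult_center by simp
      qed
      then show ?thesis by (simp add: centralizer_def)
    qed
    show "comm_group (G\<lparr>carrier := centralizer G x\<rparr>)"
      by (rule group.group_comm_groupI[OF subgroup_imp_group[OF sg]]) (simp add: comm)
  qed
  moreover have "card (Cent G) = order G div card (center G)"
    unfolding card_Cent_eq_index_center_iff[OF fin]
  proof (intro ballI impI)
    fix x y assume x: "x \<in> carrier G" and y: "y \<in> carrier G" and e: "centralizer G x = centralizer G y"
    \<comment> \<open>An element is central exactly when its centralizer is the whole group, so
      \<open>x\<close> and \<open>y\<close> are both central, with common coset \<open>Z\<close>, or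
      both noncentral.\<close>
    have zz: "x \<in> center G \<longleftrightarrow> y \<in> center G"
      using e x y centralizer_eq_carrier_iff by metis
    show "center G #> x = center G #> y"
    proof (cases "x \<in> center G")
      case True
      then show ?thesis using zz x y coset_join2[OF _ subgroup_center] by simp
    next
      case False
      have "y \<in> center G \<union> (x <# center G)"
        using S x False e centralizer_self[OF y] by (auto simp: small_centralizers_def)
      then show ?thesis using False zz x y center_coset_eq_iff by blast
    qed
  qed
  ultimately show "CA_group G \<and> card (Cent G) = order G div card (center G)" ..
qed

section \<open>Abelian direct factors\<close>

text \<open>Normal subgroups with trivial intersection commute elementwise, so an element of
  \<open>A\<close> commutes with \<open>P\<close>; it commutes with \<open>A\<close> as
  \<open>A\<close> is abelian, hence with all of \<open>AP = G\<close>.\<close>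

lemma abelian_factor_central:
  assumes dp: "internal_direct_product G A P" and ab: "comm_group (G\<lparr>carrier := A\<rparr>)"
  shows "A \<subseteq> center G"
proof
  fix a assume a: "a \<in> A"
  interpret A: normal A G using dp by (simp add: internal_direct_product_def)
  interpret P: normal P G using dp by (simp add: internal_direct_product_def)
  interpret CA: comm_group "G\<lparr>carrier := A\<rparr>" by (rule ab)
  show "a \<in> center G"
    unfolding center_def
  proof (intro CollectI conjI ballI)
    show ac: "a \<in> carrier G" using a by simp
    fix y assume "y \<in> carrier G"
    then obtain b p where b: "b \<in> A" and p: "p \<in> P" and y: "y = b \<otimes> p"
      using dp unfolding internal_direct_product_def set_mult_def by blast
    have 1: "a \<otimes> p = p \<otimes> a"
      using normal_imp_commuting[of A P a p] dp a p by (simp add: internal_direct_product_def)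
    have 2: "a \<otimes> b = b \<otimes> a" using CA.m_comm a b by simp
    have bp: "b \<in> carrier G" "p \<in> carrier G" using b p by auto
    show "a \<otimes> y = y \<otimes> a" unfolding y using 1 2 ac bp by (metis m_assoc)
  qed
qed

text \<open>The central factors collect to \<open>ab\<close> on both sides and cancel, so
  commutation in \<open>A \<times> P\<close> is decided by the components in
  \<open>P\<close>.\<close>

lemma central_factor_commute_iff:
  assumes "a \<in> center G" "b \<in> center G" "p \<in> carrier G" "q \<in> carrier G"
  shows "(a \<otimes> p) \<otimes> (b \<otimes> q) = (b \<otimes> q) \<otimes> (a \<otimes> p) \<longleftrightarrow> p \<otimes> q = q \<otimes> p"
proof -
  have ab: "a \<in> carrier G" "b \<in> carrier G" using assms by (simp_all add: center_def)
  have "(a \<otimes> p) \<otimes> (b \<otimes> q) = (a \<otimes> b) \<otimes> (p \<otimes> q)"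
    using ab assms centerD[OF assms(2) assms(3)] by (metis m_assoc m_closed)
  moreover have "(b \<otimes> q) \<otimes> (a \<otimes> p) = (a \<otimes> b) \<otimes> (q \<otimes> p)"
    using ab assms centerD[OF assms(1) assms(4)] centerD[OF assms(1) ab(2)] by (metis m_assoc m_closed)
  ultimately show ?thesis using ab assms by simp
qed

context
  fixes A P
  assumes dp: "internal_direct_product G A P" and ab: "comm_group (G\<lparr>carrier := A\<rparr>)"
begin

lemma factor_decomp:
  assumes "y \<in> carrier G"
  obtains a p where "a \<in> A" "a \<in> center G" "p \<in> P" "p \<in> carrier G" "y = a \<otimes> p"
proof -
  have "subgroup P G" using dp by (simp add: internal_direct_product_def normal_imp_subgroup)
  then show thesis
    using assms dp abelian_factor_central[OF dp ab] that subgroup.subset[of P G]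
    unfolding internal_direct_product_def set_mult_def by blast
qed

lemma center_factor: "center (G\<lparr>carrier := P\<rparr>) = center G \<inter> P"
proof -
  have sP: "subgroup P G" using dp by (simp add: internal_direct_product_def normal_imp_subgroup)
  have "p \<in> center G" if p: "p \<in> P" "\<forall>q\<in>P. p \<otimes> q = q \<otimes> p" for p
  proof -
    have pc: "p \<in> carrier G" using p subgroup.mem_carrier[OF sP] by blast
    \<comment> \<open>The identity is the central factor of \<open>p\<close> when
      \<open>central_factor_commute_iff\<close> is applied below.\<close>
    have one: "\<one> \<in> center G" using subgroup_center by (rule subgroup.one_closed)
    have "p \<otimes> y = y \<otimes> p" if "y \<in> carrier G" for y
      using that
    proof (rule factor_decomp)
      fix b q assume "b \<in> A" "b \<in> center G" "q \<in> P" "q \<in> carrier G" "y = b \<otimes> q"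
      then show ?thesis using central_factor_commute_iff[OF one _ pc, of b q] p pc by simp
    qed
    then show ?thesis using pc by (simp add: center_def)
  qed
  then show ?thesis
    using subgroup.subset[OF sP] by (auto simp: center_carrier_update intro!: centerD)
qed

text \<open>From \<open>P\<close> to \<open>G\<close>, commuting elements \<open>ap\<close> and
  \<open>bq\<close> have commuting components \<open>p\<close> and \<open>q\<close>, and the
  description of \<open>q\<close> is carried back by central factors. From \<open>G\<close> to
  \<open>P\<close>, both sides of the equation are intersected with \<open>P\<close>.\<close>

lemma small_centralizers_factor_iff:
  "small_centralizers (G\<lparr>carrier := P\<rparr>) \<longleftrightarrow> small_centralizers G"
proof -
  have sP: "subgroup P G" using dp by (simp add: internal_direct_product_def normal_imp_subgroup)
  interpret P: subgroup P G by (rule sP)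
  interpret Z: subgroup "center G" G by (rule subgroup_center)
  have cen: "centralizer (G\<lparr>carrier := P\<rparr>) x = centralizer G x \<inter> P" for x
    using P.subset by (auto simp: centralizer_def)
  show ?thesis
  proof
    assume S: "small_centralizers (G\<lparr>carrier := P\<rparr>)"
    show "small_centralizers G"
      unfolding small_centralizers_def
    proof (intro ballI equalityI)
      fix x assume x: "x \<in> carrier G - center G"
      then show "center G \<union> (x <# center G) \<subseteq> centralizer G x" using center_cosets_subset_centralizer by simp
      obtain a p where a: "a \<in> center G" and p: "p \<in> P" "p \<in> carrier G" and xe: "x = a \<otimes> p"
        using x factor_decomp by blast
      have pn: "p \<notin> center G" using x a xe Z.m_closed by blast
      show "centralizer G x \<subseteq> center G \<union> (x <# center G)"
      proof
        fix y assume y: "y \<in> centralizer G x"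
        then have "y \<in> carrier G" by (simp add: centralizer_def)
        then obtain b q where b: "b \<in> center G" and q: "q \<in> P" "q \<in> carrier G" and ye: "y = b \<otimes> q"
          using factor_decomp by blast
        have "p \<otimes> q = q \<otimes> p"
          using y central_factor_commute_iff[OF a b p(2) q(2)] by (simp add: xe ye centralizer_def)
        then have "q \<in> centralizer (G\<lparr>carrier := P\<rparr>) p" using q by (simp add: centralizer_def)
        also have "\<dots> = (center G \<inter> P) \<union> (p <# (center G \<inter> P))"
          using S p pn unfolding small_centralizers_def center_factor
          by (simp add: l_coset_carrier_update)
        finally consider "q \<in> center G" | z where "z \<in> center G" "q = p \<otimes> z"
          by (auto simp: mem_l_coset)
        then show "y \<in> center G \<union> (x <# center G)"
        proof cases
          case 1
          then show ?thesis using b ye by simp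
        next
          case (2 z)
          \<comment> \<open>Solves \<open>x \<otimes> ?w = y\<close> for \<open>x = ap\<close> and
            \<open>y = bq = bpz\<close>, where \<open>a\<close> and \<open>b\<close> are
            central.\<close>
          let ?w = "inv a \<otimes> b \<otimes> z"
          have w: "?w \<in> center G" using a b 2 by simp
          have c: "a \<in> carrier G" "b \<in> carrier G" "z \<in> carrier G" using a b 2 Z.mem_carrier by auto
          have "x \<otimes> ?w = p \<otimes> a \<otimes> ?w" unfolding xe using centerD[OF a p(2)] by simp
          also have "\<dots> = (p \<otimes> b) \<otimes> z"
          proof -
            have "a \<otimes> (inv a \<otimes> (b \<otimes> z)) = b \<otimes> z" using c by (simp flip: m_assoc)
            then show ?thesis using c p by (simp add: m_assoc)
          qed
          also have "\<dots> = y"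
            unfolding ye 2 centerD[OF b p(2), symmetric] using c p by (simp add: m_assoc)
          finally show ?thesis using w by (auto simp: mem_l_coset)
        qed
      qed
    qed
  next
    assume S: "small_centralizers G"
    show "small_centralizers (G\<lparr>carrier := P\<rparr>)"
      unfolding small_centralizers_def center_factor cen l_coset_carrier_update
    proof
      fix x assume "x \<in> carrier (G\<lparr>carrier := P\<rparr>) - center G \<inter> P"
      then have x: "x \<in> P" "x \<in> carrier G" "x \<notin> center G" by auto
      \<comment> \<open>Since \<open>x\<close> lies in the subgroup \<open>P\<close>, a product
        \<open>xz\<close> lies in \<open>P\<close> only if \<open>z\<close> does.\<close>
      have "(x <# center G) \<inter> P = x <# (center G \<inter> P)"
      proof
        show "x <# (center G \<inter> P) \<subseteq> (x <# center G) \<inter> P" using x by (auto simp: mem_l_coset)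
        show "(x <# center G) \<inter> P \<subseteq> x <# (center G \<inter> P)"
        proof
          fix y assume "y \<in> (x <# center G) \<inter> P"
          then obtain z where z: "z \<in> center G" "y = x \<otimes> z" "y \<in> P" by (auto simp: mem_l_coset)
          have "inv x \<otimes> y = z" unfolding z(2) using x Z.mem_carrier[OF z(1)] by (simp flip: m_assoc)
          then have "z \<in> P" using P.m_closed[OF P.m_inv_closed[OF x(1)] z(3)] by simp
          then show "y \<in> x <# (center G \<inter> P)" using z by (auto simp: mem_l_coset)
        qed
      qed
      then show "centralizer G x \<inter> P = center G \<inter> P \<union> (x <# (center G \<inter> P))"
        using S x by (auto simp: small_centralizers_def)
    qed
  qed
qed

text \<open>An abelian \<open>P\<close> would be central in \<open>G\<close> by
  \<open>center_factor\<close>, and then so would \<open>AP = G\<close>. This allows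
  \<open>CA_group_max_Cent_iff\<close> to be applied to \<open>P\<close>.\<close>

lemma factor_not_comm_group:
  assumes "\<not> comm_group G"
  shows "\<not> comm_group (G\<lparr>carrier := P\<rparr>)"
proof
  assume "comm_group (G\<lparr>carrier := P\<rparr>)"
  then interpret C: comm_group "G\<lparr>carrier := P\<rparr>" .
  have "P \<subseteq> center (G\<lparr>carrier := P\<rparr>)"
    using C.m_comm by (auto simp: center_carrier_update)
  then have "P \<subseteq> center G" by (simp add: center_factor)
  then have "x \<in> center G" if "x \<in> carrier G" for x
    using that subgroup.m_closed[OF subgroup_center] by (blast elim: factor_decomp)
  then have "comm_group G" by (intro group_comm_groupI centerD)
  with assms show False by simp
qed

end

section \<open>The decomposition into a central odd part and a 2-group\<close>

lemma small_centralizers_square_central: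
  assumes S: "small_centralizers G" and x: "x \<in> carrier G"
  shows "x \<otimes> x \<in> center G"
proof (cases "x \<in> center G")
  case True
  then show ?thesis by (simp add: subgroup.m_closed[OF subgroup_center])
next
  case False
  have "x \<otimes> x \<in> centralizer G x" using x by (simp add: centralizer_def m_assoc)
  then have "x \<otimes> x \<in> center G \<union> (x <# center G)"
    using S x False by (simp add: small_centralizers_def)
  moreover have "x \<otimes> x \<notin> x <# center G"
    using x False center_subset[of G] by (auto simp: mem_l_coset)
  ultimately show ?thesis by blast
qed

text \<open>Elements whose squares are central satisfy \<open>(xy)\<^sup>2 = (yx)\<^sup>2\<close>, and
  \<open>(xy)\<^sup>2(yx)\<^sup>2\<close> collapses from the inside because \<open>xyyx = x\<^sup>2y\<^sup>2\<close>.\<close>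

lemma pow_4_mult:
  assumes sq: "\<And>x. x \<in> carrier G \<Longrightarrow> x \<otimes> x \<in> center G"
    and x: "x \<in> carrier G" and y: "y \<in> carrier G"
  shows "(x \<otimes> y) [^] (4::nat) = x [^] (4::nat) \<otimes> y [^] (4::nat)"
proof -
  let ?u = "x \<otimes> y" and ?v = "y \<otimes> x" and ?X = "x \<otimes> x" and ?Y = "y \<otimes> y"
  have p4: "w [^] (4::nat) = (w \<otimes> w) \<otimes> (w \<otimes> w)" if "w \<in> carrier G" for w
    using that by (simp add: numeral_eq_Suc m_assoc)
  have X: "?X \<in> center G" "?X \<in> carrier G" and Y: "?Y \<in> center G" "?Y \<in> carrier G"
    using sq x y by auto
  \<comment> \<open>Both sides are the word \<open>xyxyx\<close>. As \<open>(xy)(xy)\<close> is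
    central, \<open>x\<close> can be moved to its left and cancelled.\<close>
  have "x \<otimes> (?v \<otimes> ?v) = (?u \<otimes> ?u) \<otimes> x" using x y by (simp add: m_assoc)
  also have "\<dots> = x \<otimes> (?u \<otimes> ?u)" using sq[of ?u] x y centerD by simp
  finally have vu: "?v \<otimes> ?v = ?u \<otimes> ?u" using x y by simp
  have uv: "?u \<otimes> ?v = ?X \<otimes> ?Y"
  proof -
    have "?u \<otimes> ?v = x \<otimes> (?Y \<otimes> x)" using x y by (simp add: m_assoc)
    also have "\<dots> = x \<otimes> (x \<otimes> ?Y)" using Y x centerD by metis
    finally show ?thesis using x y by (simp add: m_assoc)
  qed
  have XY: "?X \<otimes> ?Y \<in> center G"
    using X Y subgroup.m_closed[OF subgroup_center] by blast
  have "?u [^] (4::nat) = (?u \<otimes> ?u) \<otimes> (?v \<otimes> ?v)" using x y vu p4 by simp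
  also have "\<dots> = ?u \<otimes> ((?u \<otimes> ?v) \<otimes> ?v)" using x y by (simp add: m_assoc)
  also have "\<dots> = ?u \<otimes> (?v \<otimes> (?X \<otimes> ?Y))"
    unfolding uv using centerD[OF XY, of ?v] x y by simp
  also have "\<dots> = (?u \<otimes> ?v) \<otimes> (?X \<otimes> ?Y)" using x y by (simp add: m_assoc)
  also have "\<dots> = ?X \<otimes> ((?Y \<otimes> ?X) \<otimes> ?Y)" unfolding uv using X Y by (simp add: m_assoc)
  also have "\<dots> = ?X \<otimes> ((?X \<otimes> ?Y) \<otimes> ?Y)" using centerD[OF Y(1) X(2)] by simp
  also have "\<dots> = (?X \<otimes> ?X) \<otimes> (?Y \<otimes> ?Y)" using X Y by (simp add: m_assoc)
  also have "\<dots> = x [^] (4::nat) \<otimes> y [^] (4::nat)" using p4 x y by simp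
  finally show ?thesis .
qed

section \<open>Coprime exponents and groups of prime power order\<close>

lemma pow_coprime_eq_one:
  assumes "x \<in> carrier G" "x [^] (m::nat) = \<one>" "x [^] (n::nat) = \<one>" "coprime m n"
  shows "x = \<one>"
proof -
  have "ord x dvd m" "ord x dvd n" using assms pow_eq_id by auto
  with assms(4) have "ord x dvd 1" using coprime_common_divisor by blast
  then have "x [^] (1::nat) = \<one>" using assms(1) pow_eq_id by blast
  with assms(1) show ?thesis by simp
qed

text \<open>If a prime \<open>q\<close> other than \<open>p\<close> divided the order, Sylow's
  theorem would give a nontrivial \<open>q\<close>-subgroup, whose elements are killed by a power of
  \<open>q\<close> and by a power of \<open>p\<close> and so are trivial.\<close>

lemma order_power_of_prime:
  assumes fin: "finite (carrier G)" and p: "Factorial_Ring.prime (p::nat)"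
    and ex: "\<And>x. x \<in> carrier G \<Longrightarrow> \<exists>k. x [^] (p ^ k) = \<one>"
  shows "\<exists>k. order G = p ^ k"
proof -
  have pos: "order G > 0" using fin by (simp add: order_gt_0_iff_finite)
  obtain k n where kn: "\<not> p dvd n" "order G = n * p ^ k" using prime_power_canonical[OF p pos] by blast
  have "n = 1"
  proof (rule ccontr)
    assume "n \<noteq> 1"
    then have nu: "\<not> is_unit n" by simp
    have "n \<noteq> 0" using kn pos by auto
    then obtain q j n' where q: "Factorial_Ring.prime q" "q dvd n" "j > 0" "n = q ^ j * n'"
      using divide_out_primepow[OF _ nu] by blast
    then have "order G = q ^ j * (n' * p ^ k)" using kn by simp
    then obtain H where H: "subgroup H G" "card H = q ^ j"
      using sylow_thm[OF q(1) is_group _ fin] by blast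
    have "card H > 1" unfolding H(2) using q prime_gt_1_nat by (intro one_less_power)
    then obtain x where x: "x \<in> H" "x \<noteq> \<one>"
      by (metis One_nat_def card_le_Suc0_iff_eq card.infinite not_less subgroup.one_closed[OF H(1)] less_nat_zero_code)
    then have xc: "x \<in> carrier G" using subgroup.mem_carrier[OF H(1)] by blast
    interpret HG: group "G\<lparr>carrier := H\<rparr>" using H(1) by (rule subgroup_imp_group)
    have "x [^] (q ^ j) = \<one>"
      using HG.pow_order_eq_1[of x] x H by (simp add: order_def nat_pow_consistent[symmetric])
    moreover obtain i where "x [^] (p ^ i) = \<one>" using ex xc by blast
    \<comment> \<open>The primes differ because \<open>q\<close> divides \<open>n\<close> and
      \<open>p\<close> does not.\<close>
    moreover have "coprime (q ^ j) (p ^ i)"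
      using q p kn by (metis coprime_power_left_iff coprime_power_right_iff primes_coprime)
    ultimately have "x = \<one>" using pow_coprime_eq_one[OF xc] by blast
    with x show False by simp
  qed
  then show ?thesis using kn by auto
qed

text \<open>Closure of \<open>A\<close> under products comes from its centrality, closure of
  \<open>P\<close> from multiplicativity of fourth powers, and Bezout's identity splits each element
  into its two parts.\<close>

lemma central_squares_decomposition:
  assumes fin: "finite (carrier G)"
    and sq: "\<And>x. x \<in> carrier G \<Longrightarrow> x \<otimes> x \<in> center G"
  shows "\<exists>A P. internal_direct_product G A P \<and> comm_group (G\<lparr>carrier := A\<rparr>) \<and>
    two_group (G\<lparr>carrier := P\<rparr>)"
proof -
  interpret Z: subgroup "center G" G by (rule subgroup_center)
  define A where "A = {x \<in> carrier G. \<exists>n::nat. odd n \<and> x [^] n = \<one>}"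
  define P where "P = {x \<in> carrier G. \<exists>k::nat. x [^] ((2::nat) ^ k) = \<one>}"
  have Zpow: "z [^] (n::nat) \<in> center G" if "z \<in> center G" for z n
    using that by (induction n) auto
  have Acen: "A \<subseteq> center G"
  proof
    fix x assume "x \<in> A"
    then obtain n :: nat where x: "x \<in> carrier G" and n: "odd n" "x [^] n = \<one>" by (auto simp: A_def)
    \<comment> \<open>With \<open>n\<close> odd, \<open>x\<close> equals its power with exponent
      \<open>n + 1 = 2j\<close>, hence is a power of the central element
      \<open>x \<otimes> x\<close>.\<close>
    obtain j where j: "Suc n = 2 * j" using n by (metis dvdE even_Suc)
    have "x = x [^] (2 * j)" unfolding j[symmetric] using x n by simp
    also have "\<dots> = (x [^] (2::nat)) [^] j" using x by (simp add: nat_pow_pow)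
    also have "\<dots> = (x \<otimes> x) [^] j" using x by (simp add: numeral_2_eq_2)
    also have "\<dots> \<in> center G" using sq[OF x] Zpow by blast
    finally show "x \<in> center G" .
  qed
  have pow_one_mult: "x [^] (m * n) = \<one>" if "x \<in> carrier G" "x [^] m = \<one>" for x and m n :: nat
    using that by (metis nat_pow_one nat_pow_pow)
  have sA: "subgroup A G"
  proof (rule subgroupI)
    show "A \<subseteq> carrier G" by (auto simp: A_def)
    show "A \<noteq> {}" by (auto simp: A_def intro!: exI[of _ \<one>] exI[of _ "1::nat"])
    fix a assume "a \<in> A"
    then show "inv a \<in> A" by (auto simp: A_def nat_pow_inv)
  next
    fix a b assume ab: "a \<in> A" "b \<in> A"
    then obtain m n :: nat where
      *: "a \<in> carrier G" "b \<in> carrier G" "odd m" "odd n" "a [^] m = \<one>" "b [^] n = \<one>"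
      by (auto simp: A_def)
    have "(a \<otimes> b) [^] (m * n) = a [^] (m * n) \<otimes> b [^] (m * n)"
      using pow_mult_distrib[of a b] centerD[of a G b] ab Acen * by blast
    also have "\<dots> = \<one>"
      using * pow_one_mult[of a m n] pow_one_mult[of b n m] by (simp add: mult.commute)
    finally show "a \<otimes> b \<in> A" using * by (auto simp: A_def intro!: exI[of _ "m * n"])
  qed
  have sP: "subgroup P G"
  proof (rule subgroupI)
    show "P \<subseteq> carrier G" by (auto simp: P_def)
    show "P \<noteq> {}" by (auto simp: P_def intro!: exI[of _ \<one>])
    fix a assume "a \<in> P"
    then show "inv a \<in> P" by (auto simp: P_def nat_pow_inv)
  next
    fix a b assume "a \<in> P" "b \<in> P"
    then obtain m n :: nat where
      *: "a \<in> carrier G" "b \<in> carrier G" "a [^] ((2::nat) ^ m) = \<one>" "b [^] ((2::nat) ^ n) = \<one>"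
      by (auto simp: P_def)
    let ?N = "(2::nat) ^ (m + n)"
    have a4: "a [^] (4::nat) \<in> center G"
    proof -
      have "a [^] (4::nat) = (a \<otimes> a) \<otimes> (a \<otimes> a)" using * by (simp add: numeral_eq_Suc m_assoc)
      then show ?thesis using sq * by simp
    qed
    \<comment> \<open>The factor 4 splits the product into fourth powers; these commute, so the
      exponent \<open>?N\<close> distributes over them and kills both. The 4 accounts for the
      \<open>+ 2\<close> in the final exponent.\<close>
    have "(a \<otimes> b) [^] (4 * ?N) = (a [^] (4::nat) \<otimes> b [^] (4::nat)) [^] ?N"
      using pow_4_mult[OF sq] * by (simp add: nat_pow_pow[symmetric])
    also have "\<dots> = (a [^] (4::nat)) [^] ?N \<otimes> (b [^] (4::nat)) [^] ?N"
      using a4 * centerD[OF a4] by (intro pow_mult_distrib) auto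
    also have "\<dots> = a [^] ((2::nat) ^ m * (4 * 2 ^ n)) \<otimes> b [^] ((2::nat) ^ n * (4 * 2 ^ m))"
      using * by (simp add: nat_pow_pow power_add mult_ac)
    also have "\<dots> = \<one>" using * pow_one_mult by simp
    finally have "(a \<otimes> b) [^] ((2::nat) ^ (m + n + 2)) = \<one>"
      by (simp add: power_add mult.commute)
    then show "a \<otimes> b \<in> P" unfolding P_def using * by blast
  qed
  have Anorm: "A \<lhd> G" using central_subgroup_normal[OF sA Acen] .
  have conj_pow: "(x \<otimes> h \<otimes> inv x) [^] (n::nat) = x \<otimes> h [^] n \<otimes> inv x"
    if "x \<in> carrier G" "h \<in> carrier G" for x h n
  proof (induction n)
    case 0
    then show ?case using that by simp
  next
    case (Suc n)
    have "inv x \<otimes> (x \<otimes> (h \<otimes> inv x)) = h \<otimes> inv x" using that by (simp flip: m_assoc)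
    then show ?case using Suc that by (simp add: m_assoc)
  qed
  have Pnorm: "P \<lhd> G"
    unfolding normal_inv_iff
  proof (intro conjI ballI sP)
    fix x h assume x: "x \<in> carrier G" and "h \<in> P"
    then obtain k :: nat where h: "h \<in> carrier G" "h [^] ((2::nat) ^ k) = \<one>" by (auto simp: P_def)
    then have "(x \<otimes> h \<otimes> inv x) [^] ((2::nat) ^ k) = \<one>" using x by (simp add: conj_pow)
    then show "x \<otimes> h \<otimes> inv x \<in> P" unfolding P_def using x h by blast
  qed
  have int: "A \<inter> P = {\<one>}"
  proof
    show "A \<inter> P \<subseteq> {\<one>}"
    proof
      fix x assume "x \<in> A \<inter> P"
      then obtain n k :: nat where
        "x \<in> carrier G" "odd n" "x [^] n = \<one>" "x [^] ((2::nat) ^ k) = \<one>"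
        by (auto simp: A_def P_def)
      then show "x \<in> {\<one>}" using pow_coprime_eq_one[of x n "2 ^ k"] by simp
    qed
    show "{\<one>} \<subseteq> A \<inter> P" using subgroup.one_closed[OF sA] subgroup.one_closed[OF sP] by blast
  qed
  have prod: "A <#> P = carrier G"
  proof
    show "A <#> P \<subseteq> carrier G"
      using subgroup.subset[OF sA] subgroup.subset[OF sP] by (rule set_mult_closed)
    show "carrier G \<subseteq> A <#> P"
    proof
      fix x assume x: "x \<in> carrier G"
      have pos: "order G > 0" using fin by (simp add: order_gt_0_iff_finite)
      obtain k n where kn: "\<not> 2 dvd n" "order G = n * 2 ^ k"
        using prime_power_canonical[OF two_is_prime_nat pos] by blast
      \<comment> \<open>Bezout coefficients for \<open>2 ^ k\<close> and the odd part
        \<open>n\<close> of the order write \<open>x\<close> as a product of two of its powers, the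
        first killed by \<open>n\<close> and the second by \<open>2 ^ k\<close>. The coefficients
        may be negative, hence the integer exponents.\<close>
      have "coprime (int (2 ^ k)) (int n)" using kn by simp
      then obtain u v :: int where uv: "int (2 ^ k) * u + int n * v = 1"
        by (metis bezout_int coprime_imp_gcd_eq_1 mult.commute)
      let ?a = "x [^] (int (2 ^ k) * u)" and ?p = "x [^] (int n * v)"
      have "?a \<otimes> ?p = x" unfolding int_pow_mult[OF x, symmetric] uv using x by simp
      moreover have "?a [^] n = \<one>"
      proof -
        have "?a [^] n = x [^] (int (2 ^ k) * u * int n)"
          using int_pow_pow[OF x, of "int (2 ^ k) * u" "int n"] by (simp only: int_pow_int)
        also have "\<dots> = x [^] (int (order G) * u)" using kn by (simp add: mult_ac)
        also have "\<dots> = (x [^] order G) [^] u"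
          using int_pow_pow[OF x, of "int (order G)" u] by (simp only: int_pow_int)
        finally show ?thesis using x by (simp add: pow_order_eq_1)
      qed
      moreover have "?p [^] ((2::nat) ^ k) = \<one>"
      proof -
        have "?p [^] ((2::nat) ^ k) = x [^] (int n * v * int (2 ^ k))"
          using int_pow_pow[OF x, of "int n * v" "int (2 ^ k)"] by (simp only: int_pow_int)
        also have "\<dots> = x [^] (int (order G) * v)" using kn by (simp add: mult_ac)
        also have "\<dots> = (x [^] order G) [^] v"
          using int_pow_pow[OF x, of "int (order G)" v] by (simp only: int_pow_int)
        finally show ?thesis using x by (simp add: pow_order_eq_1)
      qed
      ultimately have "?a \<in> A" "?p \<in> P" "x = ?a \<otimes> ?p" using x kn by (auto simp: A_def P_def)
      then show "x \<in> A <#> P" by (auto simp: set_mult_def)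
    qed
  qed
  have "comm_group (G\<lparr>carrier := A\<rparr>)"
    using Acen subgroup.subset[OF sA]
    by (intro group.group_comm_groupI[OF subgroup_imp_group[OF sA]]) (auto intro!: centerD)
  moreover have "two_group (G\<lparr>carrier := P\<rparr>)"
  proof -
    interpret PG: group "G\<lparr>carrier := P\<rparr>" using sP by (rule subgroup_imp_group)
    have "finite P" using fin by (rule finite_subset[OF subgroup.subset[OF sP]])
    then have "\<exists>k. order (G\<lparr>carrier := P\<rparr>) = 2 ^ k"
      by (intro PG.order_power_of_prime) (auto simp: P_def nat_pow_consistent[symmetric])
    then show ?thesis using PG.is_group by (simp add: two_group_def)
  qed
  moreover have "internal_direct_product G A P"
    using Anorm Pnorm int prod by (simp add: internal_direct_product_def)
  ultimately show ?thesis by blast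
qed

end

(* The factor A is required to be abelian in the second and third condition: for arbitrary A
   the equivalence fails, e.g. for G = S3 x D8 and for G = S3 x 1 respectively. *)
theorem theorem3:
  fixes G :: "('a, 'b) monoid_scheme" and m :: nat
  assumes "group G" and "finite (carrier G)" and "\<not> comm_group G"
    and "m = order G div card (center G)"
  shows
    "(n_centralizer m G \<and> CA_group G \<and> m \<noteq> 2 \<and> m \<noteq> 3
       \<longleftrightarrow> (\<exists>A P. internal_direct_product G A P \<and> comm_group (G\<lparr>carrier := A\<rparr>) \<and>
             two_group (G\<lparr>carrier := P\<rparr>) \<and> CA_group (G\<lparr>carrier := P\<rparr>) \<and>
             card (Cent (G\<lparr>carrier := P\<rparr>)) =
               order (G\<lparr>carrier := P\<rparr>) div card (center (G\<lparr>carrier := P\<rparr>)))) \<and>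
     (n_centralizer m G \<and> CA_group G \<and> m \<noteq> 2 \<and> m \<noteq> 3
       \<longleftrightarrow> (\<exists>A P. internal_direct_product G A P \<and> comm_group (G\<lparr>carrier := A\<rparr>) \<and>
             (\<forall>x \<in> P - center (G\<lparr>carrier := P\<rparr>).
                centralizer (G\<lparr>carrier := P\<rparr>) x =
                  center (G\<lparr>carrier := P\<rparr>) \<union> (x <#\<^bsub>G\<lparr>carrier := P\<rparr>\<^esub> center (G\<lparr>carrier := P\<rparr>)))))"
proof -
  interpret group G by fact
  define max_Cent where "max_Cent H \<longleftrightarrow> CA_group H \<and> card (Cent H) = order H div card (center H)"
    for H :: "('a, 'b) monoid_scheme"
  have one: "n_centralizer m G \<and> CA_group G \<and> m \<noteq> 2 \<and> m \<noteq> 3 \<longleftrightarrow> small_centralizers G"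
    using CA_group_max_Cent_iff[OF assms(2,3)] card_Cent_ge_4[OF assms(2,3)] assms
    by (auto simp: n_centralizer_def)
  \<comment> \<open>For every decomposition with abelian \<open>A\<close>, both conditions on
    \<open>P\<close> amount to one condition on \<open>G\<close> alone, so a particular
    decomposition has to be constructed only for the forward directions.\<close>
  have factor: "(max_Cent (G\<lparr>carrier := P\<rparr>) \<longleftrightarrow> small_centralizers G) \<and>
      (small_centralizers (G\<lparr>carrier := P\<rparr>) \<longleftrightarrow> small_centralizers G)"
    if dp: "internal_direct_product G A P" and ab: "comm_group (G\<lparr>carrier := A\<rparr>)" for A P
  proof -
    have sP: "subgroup P G" using dp by (simp add: internal_direct_product_def normal_imp_subgroup)
    interpret P: group "G\<lparr>carrier := P\<rparr>" using sP by (rule subgroup_imp_group)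
    have "finite P" using assms(2) by (rule finite_subset[OF subgroup.subset[OF sP]])
    then show ?thesis
      unfolding max_Cent_def
      using P.CA_group_max_Cent_iff factor_not_comm_group[OF dp ab assms(3)]
        small_centralizers_factor_iff[OF dp ab] by simp
  qed
  have decomp: "\<exists>A P. internal_direct_product G A P \<and> comm_group (G\<lparr>carrier := A\<rparr>) \<and>
      two_group (G\<lparr>carrier := P\<rparr>)" if "small_centralizers G"
    using central_squares_decomposition[OF assms(2)] small_centralizers_square_central[OF that] .
  have two: "small_centralizers G \<longleftrightarrow> (\<exists>A P. internal_direct_product G A P \<and>
      comm_group (G\<lparr>carrier := A\<rparr>) \<and> two_group (G\<lparr>carrier := P\<rparr>) \<and> max_Cent (G\<lparr>carrier := P\<rparr>))"
    using decomp factor by blast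
  have three: "small_centralizers G \<longleftrightarrow> (\<exists>A P. internal_direct_product G A P \<and>
      comm_group (G\<lparr>carrier := A\<rparr>) \<and> small_centralizers (G\<lparr>carrier := P\<rparr>))"
    using decomp factor by blast
  show ?thesis
    \<comment> \<open>The pattern restricts the unfolding to subgroup records, so
      \<open>small_centralizers G\<close> stays folded and matches \<open>two\<close> and
      \<open>three\<close>.\<close>
    unfolding one using two three unfolding max_Cent_def small_centralizers_def[of "G\<lparr>carrier := _\<rparr>"]
    by simp
qed

end
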